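(* Let $S$ be a double interchange semigroup with operations $\triangle$ and $\blacktriangle$. Then for all $a,b,c,d,e,f,g,h,i,j \in S$, $$((a \triangle (b \blacktriangle c)) \blacktriangle (f \triangle (g \blacktriangle h)))\triangle ((d \triangle e)\blacktriangle (i \triangle j)) = ((a \triangle (b \blacktriangle g)) \blacktriangle (f \triangle (c \blacktriangle h)))\triangle ((d \triangle e)\blacktriangle (i \triangle j)).$$
   Context: A double interchange semigroup is a nonempty set $S$ with two binary operations $\triangle, \blacktriangle \colon S\times S\to S$, each of which is associative, and which satisfy the interchange law $(a \triangle b)\blacktriangle(c\triangle d) = (a\blacktriangle c)\triangle(b\blacktriangle d)$ for all $a,b,c,d\in S$. No unit elements are assumed. *)

theory Defs
  imports Main
begin

text \<open>
  The carrier is an explicit nonempty set; the operations are total on the ambient type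
  and only their restrictions to \<open>S\<close> matter.  The second operation, a filled triangle on paper, is
  written \<open>\<box>\<close>.
\<close>

locale double_interchange_semigroup =
  fixes S :: "'a set"
    and htimes :: "'a \<Rightarrow> 'a \<Rightarrow> 'a"  (infixl \<open>\<triangle>\<close> 70)
    and vtimes :: "'a \<Rightarrow> 'a \<Rightarrow> 'a"  (infixl \<open>\<box>\<close> 70)
  assumes nonempty: "S \<noteq> {}"
    and h_closed: "\<lbrakk>a \<in> S; b \<in> S\<rbrakk> \<Longrightarrow> a \<triangle> b \<in> S"
    and v_closed: "\<lbrakk>a \<in> S; b \<in> S\<rbrakk> \<Longrightarrow> a \<box> b \<in> S"
    and h_assoc: "\<lbrakk>a \<in> S; b \<in> S; c \<in> S\<rbrakk> \<Longrightarrow> (a \<triangle> b) \<triangle> c = a \<triangle> (b \<triangle> c)"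
    and v_assoc: "\<lbrakk>a \<in> S; b \<in> S; c \<in> S\<rbrakk> \<Longrightarrow> (a \<box> b) \<box> c = a \<box> (b \<box> c)"
    and interchange: "\<lbrakk>a \<in> S; b \<in> S; c \<in> S; d \<in> S\<rbrakk> \<Longrightarrow>
          (a \<triangle> b) \<box> (c \<triangle> d) = (a \<box> c) \<triangle> (b \<box> d)"

end

theory Submission
  imports Defs
begin

text \<open>
  Draw \<open>\<triangle>\<close> as horizontal and \<open>\<box>\<close> as vertical juxtaposition.  By interchange, both sides of the
  theorem are two rows, one above the other:
  \<open>a, b \<box> c, d, e\<close> over \<open>f, g \<box> h, i, j\<close> on the left and \<open>a, b \<box> g, d, e\<close> over \<open>f, c \<box> h, i, j\<close> on
  the right.

  Two rows can be cut into columns in any way, because associativity within each row allows its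
  entries to be grouped independently of the other row.  If entry \<open>b\<close> of the top row and entry \<open>z\<close>
  of the bottom row form a column, then a factor \<open>c\<close> can cross the line between the rows:
  \<open>(b \<box> c) \<box> z = b \<box> (c \<box> z)\<close>.  The bottom entry in second position forms a column with the top entry
  in second position when the cuts are straight (\<open>cross_straight\<close>), but it forms a column with the
  top entry in third position when the first two top entries and the last two bottom entries are
  grouped (\<open>cross_diagonal\<close>).

  Hence \<open>c\<close> can be lowered from below \<open>b\<close> into the second bottom entry and raised from there to the
  third top entry, below \<open>d\<close>.  With \<open>c\<close> out of the way, \<open>g\<close> rises straight to \<open>b\<close>; then \<open>c\<close> goes
  back down, now onto \<open>h\<close> alone.  The net effect is to interchange \<open>c\<close> and \<open>g\<close>.
\<close>

context double_interchange_semigroup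
begin

lemma interchange3:
  assumes "a \<in> S" "b \<in> S" "c \<in> S" "x \<in> S" "y \<in> S" "z \<in> S"
  shows "(a \<triangle> (b \<triangle> c)) \<box> (x \<triangle> (y \<triangle> z)) = (a \<box> x) \<triangle> ((b \<box> y) \<triangle> (c \<box> z))"
  using assms by (simp add: interchange h_closed)

lemma cross_straight:
  assumes "a \<in> S" "b \<in> S" "c \<in> S" "d \<in> S" "f \<in> S" "z \<in> S" "i \<in> S"
  shows "(a \<triangle> ((b \<box> c) \<triangle> d)) \<box> (f \<triangle> (z \<triangle> i)) = (a \<triangle> (b \<triangle> d)) \<box> (f \<triangle> ((c \<box> z) \<triangle> i))"
  using assms by (simp add: interchange3 v_closed v_assoc)

text \<open>
  This is \<open>cross_straight\<close> for the columns \<open>a \<triangle> b\<close> over \<open>f\<close>, \<open>d \<box> c\<close> over \<open>z\<close>, \<open>e\<close> over \<open>i \<triangle> j\<close>: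
  the bottom row is shifted by one place against the top row.
\<close>

lemma cross_diagonal:
  assumes "a \<in> S" "b \<in> S" "c \<in> S" "d \<in> S" "e \<in> S"
    and "f \<in> S" "z \<in> S" "i \<in> S" "j \<in> S"
  shows "(a \<triangle> (b \<triangle> ((d \<box> c) \<triangle> e))) \<box> (f \<triangle> (z \<triangle> (i \<triangle> j))) =
         (a \<triangle> (b \<triangle> (d \<triangle> e))) \<box> (f \<triangle> ((c \<box> z) \<triangle> (i \<triangle> j)))"
  using cross_straight[of "a \<triangle> b" d c e f z "i \<triangle> j"] assms
  by (simp add: h_closed v_closed h_assoc)

lemma two_rows:
  assumes "a \<in> S" "b \<in> S" "d \<in> S" "e \<in> S" "f \<in> S" "z \<in> S" "i \<in> S" "j \<in> S"
  shows "((a \<triangle> b) \<box> (f \<triangle> z)) \<triangle> ((d \<triangle> e) \<box> (i \<triangle> j)) =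
         (a \<triangle> (b \<triangle> (d \<triangle> e))) \<box> (f \<triangle> (z \<triangle> (i \<triangle> j)))"
  using interchange[of "a \<triangle> b" "d \<triangle> e" "f \<triangle> z" "i \<triangle> j"] assms
  by (simp add: h_closed h_assoc)

end

theorem theorem5p5:
  fixes S :: "'a set"
    and htimes :: "'a \<Rightarrow> 'a \<Rightarrow> 'a"  (infixl \<open>\<triangle>\<close> 70)
    and vtimes :: "'a \<Rightarrow> 'a \<Rightarrow> 'a"  (infixl \<open>\<box>\<close> 70)
    and a b c d e f g h i j :: 'a
  assumes "double_interchange_semigroup S (\<triangle>) (\<box>)"
    and "a \<in> S" "b \<in> S" "c \<in> S" "d \<in> S" "e \<in> S"
    and "f \<in> S" "g \<in> S" "h \<in> S" "i \<in> S" "j \<in> S"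
  shows "((a \<triangle> (b \<box> c)) \<box> (f \<triangle> (g \<box> h))) \<triangle> ((d \<triangle> e) \<box> (i \<triangle> j)) =
         ((a \<triangle> (b \<box> g)) \<box> (f \<triangle> (c \<box> h))) \<triangle> ((d \<triangle> e) \<box> (i \<triangle> j))"
proof -
  interpret double_interchange_semigroup S "(\<triangle>)" "(\<box>)" by fact
  note mem = assms(2-) h_closed v_closed
  have "((a \<triangle> (b \<box> c)) \<box> (f \<triangle> (g \<box> h))) \<triangle> ((d \<triangle> e) \<box> (i \<triangle> j)) =
        (a \<triangle> ((b \<box> c) \<triangle> (d \<triangle> e))) \<box> (f \<triangle> ((g \<box> h) \<triangle> (i \<triangle> j)))"
    by (rule two_rows) (simp_all add: mem)
  also have "\<dots> = (a \<triangle> (b \<triangle> (d \<triangle> e))) \<box> (f \<triangle> ((c \<box> (g \<box> h)) \<triangle> (i \<triangle> j)))"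
    by (rule cross_straight) (simp_all add: mem)
  also have "\<dots> = (a \<triangle> (b \<triangle> ((d \<box> c) \<triangle> e))) \<box> (f \<triangle> ((g \<box> h) \<triangle> (i \<triangle> j)))"
    by (rule cross_diagonal[symmetric]) (simp_all add: mem)
  also have "\<dots> = (a \<triangle> ((b \<box> g) \<triangle> ((d \<box> c) \<triangle> e))) \<box> (f \<triangle> (h \<triangle> (i \<triangle> j)))"
    by (rule cross_straight[symmetric]) (simp_all add: mem)
  also have "\<dots> = (a \<triangle> ((b \<box> g) \<triangle> (d \<triangle> e))) \<box> (f \<triangle> ((c \<box> h) \<triangle> (i \<triangle> j)))"
    by (rule cross_diagonal) (simp_all add: mem)
  also have "\<dots> = ((a \<triangle> (b \<box> g)) \<box> (f \<triangle> (c \<box> h))) \<triangle> ((d \<triangle> e) \<box> (i \<triangle> j))"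
    by (rule two_rows[symmetric]) (simp_all add: mem)
  finally show ?thesis .
qed

end
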